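(* For all non-negative integers $n$ and $l$ and for all positive integers $m$, the integer $$\Psi(2n,m,l)=\sum_{k=0}^{2n}(-1)^k\binom{2n}{k}^m S(k,l)\,S(2n-k,l)$$ is divisible by $S(n,l)$.
   Context: For non-negative integers $a$ and $b$, the super Catalan number is $S(a,b)=\dfrac{\binom{2a}{a}\binom{2b}{b}}{\binom{a+b}{a}}=\dfrac{(2a)!\,(2b)!}{a!\,b!\,(a+b)!}$; it is always an integer. Divisibility is in the ring of integers. *)

theory Defs
  imports Complex_Main
begin

definition super_catalan :: "nat \<Rightarrow> nat \<Rightarrow> nat" where
  "super_catalan a b =
     (((2 * a) choose a) * ((2 * b) choose b)) div ((a + b) choose a)"

text \<open>The division in the definition is exact (\<open>super_catalan_dvd\<close> below), by
  the recurrence \<open>S(a, b + 1) = 4 S(a, b) - S(a + 1, b)\<close> for the rational quotient.\<close>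

lemma super_catalan_fact_rat:
  "(of_nat (((2 * a) choose a) * ((2 * b) choose b)) :: rat) / of_nat ((a + b) choose a) =
     fact (2 * a) * fact (2 * b) / (fact a * fact b * fact (a + b))"
  by (simp add: binomial_fact mult_2 divide_simps)

lemma super_catalan_fact_Ints:
  "(fact (2 * a) * fact (2 * b) / (fact a * fact b * fact (a + b)) :: rat) \<in> \<int>"
proof (induction b arbitrary: a)
  case 0
  have "(fact (2 * a) * fact (2 * 0) / (fact a * fact 0 * fact (a + 0)) :: rat) =
          of_nat ((2 * a) choose a)"
    by (simp add: binomial_fact mult_2)
  then show ?case by (metis Ints_of_nat)
next
  case (Suc b)
  let ?S = "\<lambda>a b. fact (2 * a) * fact (2 * b) / (fact a * fact b * fact (a + b)) :: rat"
  have frac: "p * (2 * x * z * q) / (u * (x * v) * (y * w)) = p * q / (u * v * w) * (2 * z / y)"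
    if "x \<noteq> 0" for p q u v w x y z :: rat
    using that by (simp add: mult_ac)
  have "?S a (Suc b) = 4 * ?S a b - ?S (Suc a) b"
  proof -
    have f1: "fact (2 * Suc i) = (2 * (of_nat i + 1) * (2 * of_nat i + 1) * fact (2 * i) :: rat)"
      and f2: "fact (Suc i) = ((of_nat i + 1) * fact i :: rat)" for i
      by (simp_all add: algebra_simps)
    have f3: "(of_nat i + 1 :: rat) \<noteq> 0" for i
      by (metis of_nat_Suc add.commute of_nat_neq_0)
    have S1: "?S a (Suc b) = ?S a b * (2 * (2 * of_nat b + 1) / (of_nat a + of_nat b + 1))"
      unfolding add_Suc_right f1 f2 of_nat_add by (rule frac) (rule f3)
    have "?S (Suc a) b = fact (2 * b) * fact (2 * Suc a) / (fact b * fact (Suc a) * fact (Suc (a + b)))"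
      by (simp only: add_Suc mult.commute)
    also have "\<dots> = fact (2 * b) * fact (2 * a) / (fact b * fact a * fact (a + b)) *
        (2 * (2 * of_nat a + 1) / (of_nat a + of_nat b + 1))"
      unfolding f1 f2 of_nat_add by (rule frac) (rule f3)
    finally have S2: "?S (Suc a) b = ?S a b * (2 * (2 * of_nat a + 1) / (of_nat a + of_nat b + 1))"
      by (simp only: mult.commute)
    have nz: "(of_nat a + of_nat b + 1 :: rat) \<noteq> 0"
      by (metis of_nat_Suc of_nat_add add.commute of_nat_neq_0)
    have "(2 * (2 * of_nat b + 1) / (of_nat a + of_nat b + 1) :: rat) =
            4 - 2 * (2 * of_nat a + 1) / (of_nat a + of_nat b + 1)"
      using nz by (simp add: field_simps)
    then show ?thesis unfolding S1 S2 by (simp only: right_diff_distrib mult.commute)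
  qed
  moreover have "4 * ?S a b - ?S (Suc a) b \<in> \<int>"
    by (intro Ints_diff Ints_mult Suc.IH) simp
  ultimately show ?case by simp
qed

lemma super_catalan_dvd:
  "((a + b) choose a) dvd ((2 * a) choose a) * ((2 * b) choose b)"
proof -
  have "(of_nat (((2 * a) choose a) * ((2 * b) choose b)) :: rat) / of_nat ((a + b) choose a) \<in> \<int>"
    unfolding super_catalan_fact_rat by (rule super_catalan_fact_Ints)
  then obtain z where z: "(of_nat (((2 * a) choose a) * ((2 * b) choose b)) :: rat) /
      of_nat ((a + b) choose a) = of_int z"
    by (elim Ints_cases)
  have "(of_nat ((a + b) choose a) :: rat) \<noteq> 0" by simp
  with z have "(of_nat (((2 * a) choose a) * ((2 * b) choose b)) :: rat) =
      of_int z * of_nat ((a + b) choose a)"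
    by (metis nonzero_eq_divide_eq)
  then have "(of_int (int (((2 * a) choose a) * ((2 * b) choose b))) :: rat) =
      of_int (int ((a + b) choose a) * z)"
    by simp
  then have "int (((2 * a) choose a) * ((2 * b) choose b)) = int ((a + b) choose a) * z"
    by (simp only: of_int_eq_iff)
  then have "int ((a + b) choose a) dvd int (((2 * a) choose a) * ((2 * b) choose b))"
    by (rule dvdI)
  then show ?thesis by (simp only: int_dvd_int_iff)
qed

lemma super_catalan_fact:
  "(of_nat (super_catalan a b) :: rat) =
     fact (2 * a) * fact (2 * b) / (fact a * fact b * fact (a + b))"
proof -
  have "(of_nat (x div d) :: rat) = of_nat x / of_nat d" if "d dvd x" "d > 0" for x d :: nat
    using that by (elim dvdE) simp
  then show ?thesis
    unfolding super_catalan_def super_catalan_fact_rat [symmetric]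
    using super_catalan_dvd by simp
qed

end

theory Submission
  imports Defs
begin

text \<open>With \<open>p = 2n\<close>, Vandermonde's identity shows that \<open>(p choose k) ^ m\<close> is for \<open>m > 0\<close>
  an integral combination of the kernels \<open>L\<^sub>j(k) = (p choose j) (p - j choose k) (k choose j)\<close>.
  So it suffices that \<open>S(n, l)\<close> divides the alternating sum of \<open>L\<^sub>j(k) S(k, l) S(2n - k, l)\<close>.
  That sum is a well-poised hypergeometric sum (Dixon; equivalently, as \<open>S(k, l)\<close> is a Beta
  integral, a two-dimensional Selberg integral), and its closed form is
  \<open>\<plusminus> S(n, l) S(n, l + n - j) (n choose j) (2j choose j)\<close>.\<close>

section \<open>Expansion of powers of binomial coefficients in kernels\<close>

text \<open>The multinomial coefficient \<open>p! / (j!^2 (k - j)! (p - j - k)!)\<close>, zero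
  unless \<open>j \<le> k \<le> p - j\<close>; for \<open>j = 0\<close> it is
  \<open>p choose k\<close>.\<close>

definition binomial_kernel :: "nat \<Rightarrow> nat \<Rightarrow> nat \<Rightarrow> nat" where
  "binomial_kernel p j k = (p choose j) * ((p - j) choose k) * (k choose j)"

text \<open>Both sides count the ordered pairs of disjoint subsets of sizes \<open>u\<close> and
  \<open>k\<close> in an \<open>m\<close>-set.\<close>

lemma choose_mult_choose_commute:
  "(m choose u) * ((m - u) choose k) = (m choose k) * ((m - k) choose u)"
proof (cases "u + k \<le> m")
  case True
  then show ?thesis
    using choose_mult[of u "u + k" m] choose_mult[of k "u + k" m]
    by (simp add: binomial_symmetric[of u "u + k"])
next
  case False
  then have "m < u \<or> m - u < k" "m < k \<or> m - k < u" by auto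
  then show ?thesis by (auto simp: binomial_eq_0)
qed

text \<open>Vandermonde after reflecting \<open>k choose (j + u)\<close> to
  \<open>k choose (k - j - u)\<close>. For \<open>k < j\<close> every term is zero while the
  truncated \<open>k - j\<close> would give 1, hence \<open>of_bool\<close>.\<close>

lemma vandermonde_shift:
  assumes "k \<le> m"
  shows "(\<Sum>u\<le>m. ((m - k) choose u) * (k choose (j + u))) = (m choose (k - j)) * of_bool (j \<le> k)"
proof (cases "j \<le> k")
  case True
  have "(\<Sum>u\<le>m. ((m - k) choose u) * (k choose (j + u)))
      = (\<Sum>u\<le>k - j. ((m - k) choose u) * (k choose (j + u)))"
    using assms by (intro sum.mono_neutral_right) auto
  also have "\<dots> = (\<Sum>u\<le>k - j. ((m - k) choose u) * (k choose (k - j - u)))"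
    using True by (intro sum.cong refl) (simp add: binomial_symmetric[of "j + _" k])
  also have "\<dots> = m choose (k - j)"
    using vandermonde[of "m - k" k "k - j"] assms by simp
  finally show ?thesis using True by simp
qed simp

text \<open>This drives the induction on the exponent: a factor \<open>p choose k\<close> is traded
  for kernels of index at least \<open>j\<close>, with integral coefficients free of
  \<open>k\<close>.\<close>

lemma binomial_mult_kernel:
  assumes "j \<le> p" "k \<le> p"
  shows "(p choose k) * binomial_kernel p j k = (p choose j) * (\<Sum>i=j..p. (i choose j) * binomial_kernel p i k)"
proof -
  have "(\<Sum>i=j..p. (i choose j) * binomial_kernel p i k)
      = (\<Sum>u\<le>p - j. ((j + u) choose j) * binomial_kernel p (j + u) k)"
    using assms by (intro sum.reindex_bij_witness[of _ "\<lambda>u. j + u" "\<lambda>i. i - j"]) auto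
  also have "\<dots> = (\<Sum>u\<le>p - j. (p choose j) * ((p - j) choose k)
      * (((p - j - k) choose u) * (k choose (j + u))))"
  proof (intro sum.cong refl)
    fix u assume "u \<in> {..p - j}"
    then have "(p choose (j + u)) * ((j + u) choose j) = (p choose j) * ((p - j) choose u)"
      using assms choose_mult[of j "j + u" p] by simp
    then have "((j + u) choose j) * binomial_kernel p (j + u) k
        = (p choose j) * (((p - j) choose u) * ((p - j - u) choose k)) * (k choose (j + u))"
      by (simp add: binomial_kernel_def mult_ac)
    then show "((j + u) choose j) * binomial_kernel p (j + u) k = (p choose j) * ((p - j) choose k)
      * (((p - j - k) choose u) * (k choose (j + u)))"
      by (simp only: choose_mult_choose_commute mult_ac)
  qed
  also have "\<dots> = (p choose j) * ((p - j) choose k)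
      * (\<Sum>u\<le>p - j. ((p - j - k) choose u) * (k choose (j + u)))"
    by (simp only: sum_distrib_left)
  \<comment> \<open>For \<open>j \<le> k \<le> p - j\<close>, \<open>vandermonde_shift\<close>
    leaves \<open>(p - j) choose (k - j)\<close>, whose product with \<open>p choose j\<close> is
    \<open>(p choose k) * (k choose j)\<close>; otherwise both sides vanish.\<close>
  also have "\<dots> = (p choose k) * (k choose j) * ((p - j) choose k)"
  proof (cases "k \<le> p - j")
    case True
    then show ?thesis
      using vandermonde_shift[of k "p - j" j] choose_mult[of j k p] assms
      by (cases "j \<le> k") (simp_all add: mult_ac binomial_eq_0)
  qed simp
  finally show ?thesis by (simp add: binomial_kernel_def mult_ac)
qed

text \<open>The induction on \<open>t\<close> treats all \<open>j\<close> at once, since absorbing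
  one factor by \<open>binomial_mult_kernel\<close> leads from \<open>j\<close> to every
  \<open>i\<close> with \<open>j \<le> i \<le> p\<close>.\<close>

lemma dvd_sum_kernel_power:
  fixes d :: int and F :: "nat \<Rightarrow> int"
  assumes "\<And>j. j \<le> p \<Longrightarrow> d dvd (\<Sum>k\<le>p. int (binomial_kernel p j k) * F k)"
    and "j \<le> p"
  shows "d dvd (\<Sum>k\<le>p. int (binomial_kernel p j k) * int (p choose k) ^ t * F k)"
  using assms(2)
proof (induction t arbitrary: j)
  case 0
  then show ?case using assms(1) by simp
next
  case (Suc t)
  have "(\<Sum>k\<le>p. int (binomial_kernel p j k) * int (p choose k) ^ Suc t * F k)
      = (\<Sum>k\<le>p. int ((p choose k) * binomial_kernel p j k) * (int (p choose k) ^ t * F k))"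
    by (simp add: mult_ac)
  also have "\<dots> = (\<Sum>k\<le>p. \<Sum>i=j..p. int ((p choose j) * (i choose j))
      * (int (binomial_kernel p i k) * int (p choose k) ^ t * F k))"
    using Suc.prems
    by (intro sum.cong refl)
      (simp add: binomial_mult_kernel sum_distrib_left sum_distrib_right mult_ac
        del: of_nat_mult, simp add: mult_ac)
  also have "\<dots> = (\<Sum>i=j..p. int ((p choose j) * (i choose j))
      * (\<Sum>k\<le>p. int (binomial_kernel p i k) * int (p choose k) ^ t * F k))"
    by (subst sum.swap) (simp only: sum_distrib_left)
  finally show ?case by (auto intro!: dvd_sum dvd_mult Suc.IH)
qed

section \<open>Creative telescoping for Dixon's sum\<close>

text \<open>The recurrence of Dixon's sum; the right-hand side is its Gosper certificate.\<close>

lemma dixon_certificate: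
  fixes k l n :: rat
  assumes "k = of_nat w - of_nat N"
  shows "(2 * n - 2 * of_nat N - 1) * (l + n + of_nat N + 1) * of_nat (Suc (Suc (2 * N)) choose Suc w)
      + 2 * (2 * l + 2 * of_nat N + 1) * (2 * of_nat N + 1) * of_nat (2 * N choose w)
    = (2 * n + 2 * k + 1) * (n + l - k) * of_nat (Suc (2 * N) choose Suc w)
      + (n + l + k) * (2 * n - 2 * k + 1) * of_nat (Suc (2 * N) choose w)"
    (is "?\<alpha> * _ + 2 * ?s * _ * ?p = ?X * ?c1 + ?Y * ?c0")
proof -
  have c1: "(of_nat N + 1 + k) * ?c1 = (2 * of_nat N + 1) * ?p"
  proof -
    have "(of_nat (Suc w * (Suc (2 * N) choose Suc w)) :: rat)
        = of_nat (Suc (2 * N) * (2 * N choose w))"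
      by (simp only: Suc_times_binomial_eq mult.commute)
    then show ?thesis using assms by (simp add: algebra_simps del: binomial_Suc_Suc)
  qed
  have c0: "(of_nat N + 1 - k) * ?c0 = (2 * of_nat N + 1) * ?p"
  proof (cases "w \<le> 2 * N")
    case True
    have "(Suc (2 * N) - w) * (Suc (2 * N) choose w) = Suc (2 * N) * (2 * N choose w)"
      using binomial_absorb_comp[of "Suc (2 * N)" w] by simp
    then have "(of_nat (Suc (2 * N) - w) * ?c0 :: rat) = of_nat (Suc (2 * N)) * ?p"
      by (metis of_nat_mult)
    moreover have "(of_nat (Suc (2 * N) - w) :: rat) = of_nat N + 1 - k"
      using assms True by (simp add: of_nat_diff)
    ultimately show ?thesis by (simp add: add.commute del: binomial_Suc_Suc)
  next
    case False
    \<comment> \<open>At \<open>w = Suc (2 * N)\<close> the binomial \<open>?c0\<close> is 1, but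
      its factor \<open>N + 1 - k\<close> is 0; beyond that the binomials vanish.\<close>
    then show ?thesis using assms by (cases "w = Suc (2 * N)") (auto simp: binomial_eq_0)
  qed
  have "(of_nat (Suc (Suc (2 * N)) choose Suc w) :: rat) = ?c0 + ?c1"
    by (simp only: binomial_Suc_Suc[of "Suc (2 * N)"] of_nat_add)
  \<comment> \<open>\<open>?X\<close> and \<open>?Y\<close> exceed \<open>?\<alpha>\<close> by
    \<open>(N + 1 + k) * (2 * l + 2 * N + 1 - 2 * k)\<close> and
    \<open>(N + 1 - k) * (2 * l + 2 * N + 1 + 2 * k)\<close>. Through \<open>c1\<close> and
    \<open>c0\<close> these become multiples of \<open>?p\<close> in whose sum \<open>k\<close>
    cancels.\<close>
  with c0 c1 show ?thesis by algebra
qed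

text \<open>Weighted by the alternating sequence, the certificate telescopes because of
  \<open>rec\<close>. The sum shortens by two terms while its centre \<open>n\<close> stays the
  same.\<close>

lemma dixon_step:
  fixes a :: "nat \<Rightarrow> rat"
  assumes rec: "\<And>i. i < 2 * n \<Longrightarrow>
      a (Suc i) * ((4 * of_nat n - 2 * of_nat i - 1) * (of_nat i + of_nat l + 1))
      = a i * ((2 * of_nat i + 1) * (2 * of_nat n + of_nat l - of_nat i))"
    and n: "n = Suc (j + N)"
  shows "(2 * of_nat j + 1) * (of_nat l + of_nat n + of_nat N + 1)
      * (\<Sum>v\<le>Suc (Suc (2 * N)). (- 1) ^ v * (of_nat (Suc (Suc (2 * N)) choose v) * a (j + v)))
    = 2 * (2 * of_nat l + 2 * of_nat N + 1) * (2 * of_nat N + 1)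
      * (\<Sum>v\<le>2 * N. (- 1) ^ v * (of_nat (2 * N choose v) * a (Suc j + v)))"
proof -
  let ?M = "Suc (Suc (2 * N))"
  define \<alpha> :: rat where "\<alpha> = (2 * of_nat j + 1) * (of_nat l + of_nat n + of_nat N + 1)"
  define \<beta> :: rat where "\<beta> = 2 * (2 * of_nat l + 2 * of_nat N + 1) * (2 * of_nat N + 1)"
  define X :: "nat \<Rightarrow> rat"
    where "X v = (2 * of_nat (j + v) + 1) * (2 * of_nat n + of_nat l - of_nat (j + v))" for v
  define Y :: "nat \<Rightarrow> rat"
    where "Y v = (4 * of_nat n - 2 * of_nat (j + v) + 1) * (of_nat (j + v) + of_nat l)" for v
  define g :: "nat \<Rightarrow> rat" where "g v = (- 1) ^ v * a (j + v)" for v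
  have XY: "g (Suc v) * Y (Suc v) = - (g v * X v)" if "v \<le> Suc (2 * N)" for v
  proof -
    have "a (Suc (j + v)) * Y (Suc v) = a (j + v) * X v"
      using rec[of "j + v"] that n by (simp add: X_def Y_def algebra_simps)
    then show ?thesis by (simp add: g_def mult.assoc)
  qed
  \<comment> \<open>Here \<open>j + Suc w = n + k\<close> with \<open>k = w - N\<close>, so the
    certificate is centred at \<open>n\<close>.\<close>
  have key: "\<alpha> * of_nat (?M choose Suc w) + \<beta> * of_nat (2 * N choose w)
      = X (Suc w) * of_nat (Suc (2 * N) choose Suc w) + Y (Suc w) * of_nat (Suc (2 * N) choose w)" for w
    using dixon_certificate[of "of_nat w - of_nat N" w N "of_nat n" "of_nat l"]
    by (simp add: \<alpha>_def \<beta>_def X_def Y_def n algebra_simps del: binomial_Suc_Suc)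
  have X0: "X 0 = \<alpha>" by (simp add: X_def \<alpha>_def n algebra_simps)
  have "\<alpha> * (\<Sum>v\<le>?M. g v * of_nat (?M choose v))
      = g 0 * X 0 + (\<Sum>w\<le>Suc (2 * N). g (Suc w) * (\<alpha> * of_nat (?M choose Suc w)))"
    by (subst sum.atMost_Suc_shift)
      (simp add: X0 distrib_left sum_distrib_left mult_ac del: binomial_Suc_Suc sum.atMost_Suc)
  also have "(\<Sum>w\<le>Suc (2 * N). g (Suc w) * (\<alpha> * of_nat (?M choose Suc w)))
      = (\<Sum>w\<le>Suc (2 * N). g (Suc w) * X (Suc w) * of_nat (Suc (2 * N) choose Suc w))
        + (\<Sum>w\<le>Suc (2 * N). g (Suc w) * Y (Suc w) * of_nat (Suc (2 * N) choose w))
        - (\<Sum>w\<le>Suc (2 * N). \<beta> * (g (Suc w) * of_nat (2 * N choose w)))"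
    unfolding sum.distrib[symmetric] sum_subtractf[symmetric]
  proof (intro sum.cong refl)
    fix w
    show "g (Suc w) * (\<alpha> * of_nat (?M choose Suc w))
        = g (Suc w) * X (Suc w) * of_nat (Suc (2 * N) choose Suc w)
          + g (Suc w) * Y (Suc w) * of_nat (Suc (2 * N) choose w)
          - \<beta> * (g (Suc w) * of_nat (2 * N choose w))"
      using arg_cong[OF key[of w], of "\<lambda>x. g (Suc w) * x"]
      by (simp add: algebra_simps del: binomial_Suc_Suc)
  qed
  \<comment> \<open>\<open>XY\<close> turns the \<open>Y\<close>-sum into minus the
    \<open>X\<close>-sum one index lower. Its term at 0 cancels \<open>g 0 * X 0\<close>, and the
    rest cancels the other \<open>X\<close>-sum.\<close>
  also have "(\<Sum>w\<le>Suc (2 * N). g (Suc w) * Y (Suc w) * of_nat (Suc (2 * N) choose w))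
      = - (\<Sum>w\<le>Suc (2 * N). g w * X w * of_nat (Suc (2 * N) choose w))"
    unfolding sum_negf[symmetric] by (intro sum.cong refl) (simp add: XY)
  also have "(\<Sum>w\<le>Suc (2 * N). g w * X w * of_nat (Suc (2 * N) choose w))
      = (\<Sum>w\<le>?M. g w * X w * of_nat (Suc (2 * N) choose w))"
    by (simp add: binomial_eq_0 del: binomial_Suc_Suc)
  also have "\<dots> = g 0 * X 0
      + (\<Sum>w\<le>Suc (2 * N). g (Suc w) * X (Suc w) * of_nat (Suc (2 * N) choose Suc w))"
    by (subst sum.atMost_Suc_shift) simp
  also have "(\<Sum>w\<le>Suc (2 * N). \<beta> * (g (Suc w) * of_nat (2 * N choose w)))
      = \<beta> * (\<Sum>w\<le>2 * N. g (Suc w) * of_nat (2 * N choose w))"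
    by (simp add: sum_distrib_left binomial_eq_0)
  finally have "\<alpha> * (\<Sum>v\<le>?M. g v * of_nat (?M choose v))
      = - (\<beta> * (\<Sum>w\<le>2 * N. g (Suc w) * of_nat (2 * N choose w)))"
    by simp
  then show ?thesis
    by (simp add: \<alpha>_def \<beta>_def g_def sum_negf mult_ac del: binomial_Suc_Suc sum.atMost_Suc)
qed

section \<open>Closed form of the alternating sums of super Catalan numbers\<close>

lemma super_catalan_rec:
  "(of_nat (super_catalan (Suc i) l) :: rat) * (of_nat i + of_nat l + 1)
    = 2 * (2 * of_nat i + 1) * of_nat (super_catalan i l)"
proof -
  have nz: "(of_nat i + of_nat l + 1 :: rat) \<noteq> 0" "(of_nat i + 1 :: rat) \<noteq> 0"
    by (metis of_nat_Suc of_nat_add add.commute of_nat_neq_0)+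
  have f: "fact (2 * Suc i) = (2 * (of_nat i + 1) * (2 * of_nat i + 1) * fact (2 * i) :: rat)"
    "fact (Suc i) = ((of_nat i + 1) * fact i :: rat)"
    "fact (Suc i + l) = ((of_nat i + of_nat l + 1) * fact (i + l) :: rat)"
    by (simp_all add: algebra_simps)
  show ?thesis unfolding super_catalan_fact f
    using nz by (simp add: divide_simps) (simp add: algebra_simps)
qed

text \<open>The induction trades \<open>(j, Suc N)\<close> for \<open>(Suc j, N)\<close>, so the
  factor \<open>super_catalan (j + N) l\<close> is preserved. It ends in a single term, the square
  of that factor; the second copy and the ratios from \<open>dixon_step\<close> make up the
  quotient.\<close>

lemma alternating_sum_super_catalan:
  "(\<Sum>v\<le>2 * N. (- 1) ^ v * (of_nat (2 * N choose v)
      * of_nat (super_catalan (j + v) l * super_catalan (2 * (j + N) - (j + v)) l))) =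
    (of_nat (super_catalan (j + N) l) :: rat) * (fact (2 * j) * fact (2 * (l + N)) * fact (2 * N)
      / (fact j * fact (l + N) * fact (l + j + 2 * N) * fact N))"
proof (induction N arbitrary: j)
  case 0
  then show ?case by (simp add: super_catalan_fact add.commute)
next
  case (Suc N)
  define n where "n = Suc (j + N)"
  define a :: "nat \<Rightarrow> rat"
    where "a i = of_nat (super_catalan i l * super_catalan (2 * n - i) l)" for i
  have rec: "a (Suc i) * ((4 * of_nat n - 2 * of_nat i - 1) * (of_nat i + of_nat l + 1))
      = a i * ((2 * of_nat i + 1) * (2 * of_nat n + of_nat l - of_nat i))" if "i < 2 * n" for i
  proof -
    \<comment> \<open>\<open>super_catalan_rec\<close> is used upwards at \<open>i\<close> and
      backwards at \<open>d\<close>; the factor 2 produced by the first is consumed by the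
      second.\<close>
    define d where "d = 2 * n - Suc i"
    have d: "2 * n - i = Suc d" "2 * n - Suc i = d" using that by (auto simp: d_def)
    have "2 * n = Suc (i + d)" using that by (auto simp: d_def)
    then have "2 * (of_nat n :: rat) = of_nat i + of_nat d + 1"
      by (metis add.commute of_nat_Suc of_nat_add of_nat_mult of_nat_numeral)
    then have e: "4 * (of_nat n :: rat) - 2 * of_nat i - 1 = 2 * of_nat d + 1"
      "2 * of_nat n + of_nat l - of_nat i = (of_nat d + of_nat l + 1 :: rat)" by simp_all
    have "a (Suc i) * ((4 * of_nat n - 2 * of_nat i - 1) * (of_nat i + of_nat l + 1))
       = (of_nat (super_catalan (Suc i) l) * (of_nat i + of_nat l + 1))
         * (of_nat (super_catalan d l) * (2 * of_nat d + 1))"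
      unfolding a_def d e by simp
    also have "\<dots> = (2 * of_nat i + 1) * of_nat (super_catalan i l)
         * (2 * (2 * of_nat d + 1) * of_nat (super_catalan d l))"
      unfolding super_catalan_rec by (simp add: algebra_simps)
    also have "\<dots> = a i * ((2 * of_nat i + 1) * (2 * of_nat n + of_nat l - of_nat i))"
      unfolding super_catalan_rec[symmetric] a_def d e by simp
    finally show ?thesis .
  qed
  let ?H' = "\<Sum>v\<le>Suc (Suc (2 * N)). (- 1) ^ v * (of_nat (Suc (Suc (2 * N)) choose v) * a (j + v))"
  let ?H = "\<Sum>v\<le>2 * N. (- 1) ^ v * (of_nat (2 * N choose v) * a (Suc j + v))"
  let ?\<alpha> = "(2 * of_nat j + 1) * (of_nat l + of_nat n + of_nat N + 1) :: rat"
  let ?\<beta> = "2 * (2 * of_nat l + 2 * of_nat N + 1) * (2 * of_nat N + 1) :: rat"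
  have pos: "2 * of_nat j + 1 > (0 :: rat)" "of_nat l + of_nat n + of_nat N + 1 > (0 :: rat)"
    "of_nat l + of_nat N + 1 > (0 :: rat)" "of_nat N + 1 > (0 :: rat)" "of_nat j + 1 > (0 :: rat)"
    by (simp_all add: add_nonneg_pos)
  have step: "?\<alpha> * ?H' = ?\<beta> * ?H"
    by (rule dixon_step[OF rec n_def])
  have IH: "?H = of_nat (super_catalan n l) * (fact (2 * Suc j) * fact (2 * (l + N)) * fact (2 * N)
      / (fact (Suc j) * fact (l + N) * fact (l + Suc j + 2 * N) * fact N))"
    using Suc.IH[of "Suc j"] by (simp add: a_def n_def)
  have f: "fact (2 * Suc i) = (2 * (of_nat i + 1) * (2 * of_nat i + 1) * fact (2 * i) :: rat)"
    "fact (Suc i) = ((of_nat i + 1) * fact i :: rat)" for i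
    by (simp_all add: algebra_simps)
  have f': "fact (l + j + 2 * Suc N)
      = ((of_nat l + of_nat n + of_nat N + 1) * fact (l + Suc j + 2 * N) :: rat)"
    by (simp add: n_def algebra_simps)
  have "?H' = ?\<beta> * ?H / ?\<alpha>"
    using step pos by (simp add: nonzero_eq_divide_eq mult.commute)
  also have "\<dots> = of_nat (super_catalan n l) * (fact (2 * j) * fact (2 * (l + Suc N)) * fact (2 * Suc N)
      / (fact j * fact (l + Suc N) * fact (l + j + 2 * Suc N) * fact (Suc N)))"
    unfolding IH f f' add_Suc_right[of l N] of_nat_add
    using pos by (simp add: divide_simps) (simp add: algebra_simps)
  finally show ?case by (simp add: a_def n_def)
qed

text \<open>At \<open>k = j + v\<close> with \<open>v \<le> 2 * N\<close> the kernel is a constant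
  times \<open>2 * N choose v\<close>, and elsewhere it vanishes; this reduces the sum to
  \<open>alternating_sum_super_catalan\<close>.\<close>

lemma sum_kernel_super_catalan:
  assumes "n = j + N"
  shows "(\<Sum>k\<le>2 * n. int (binomial_kernel (2 * n) j k) * ((- 1) ^ k
      * int (super_catalan k l) * int (super_catalan (2 * n - k) l)))
    = (- 1) ^ j * int (super_catalan n l * super_catalan n (l + N) * (n choose j) * (2 * j choose j))"
proof -
  let ?F = "\<lambda>k. (- 1) ^ k * int (super_catalan k l) * int (super_catalan (2 * n - k) l)"
  let ?C = "int ((2 * n choose j) * ((2 * n - j) choose j))"
  let ?H = "\<Sum>v\<le>2 * N. (- 1) ^ v * (int (2 * N choose v)
      * int (super_catalan (j + v) l * super_catalan (2 * n - (j + v)) l))"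
  have "(\<Sum>k\<le>2 * n. int (binomial_kernel (2 * n) j k) * ?F k)
      = (\<Sum>k=j..j + 2 * N. int (binomial_kernel (2 * n) j k) * ?F k)"
    using assms by (intro sum.mono_neutral_right) (auto simp: binomial_kernel_def)
  also have "\<dots> = (\<Sum>v\<le>2 * N. int (binomial_kernel (2 * n) j (j + v)) * ?F (j + v))"
    by (intro sum.reindex_bij_witness[of _ "\<lambda>v. j + v" "\<lambda>i. i - j"]) auto
  also have "\<dots> = (- 1) ^ j * (?C * ?H)"
    unfolding sum_distrib_left
  proof (intro sum.cong refl)
    fix v assume "v \<in> {..2 * N}"
    then have "((2 * n - j) choose (j + v)) * ((j + v) choose j)
        = ((2 * n - j) choose j) * (2 * N choose v)"
      using choose_mult[of j "j + v" "2 * n - j"] assms by simp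
    then have "binomial_kernel (2 * n) j (j + v)
        = (2 * n choose j) * ((2 * n - j) choose j) * (2 * N choose v)"
      by (simp add: binomial_kernel_def mult_ac)
    then show "int (binomial_kernel (2 * n) j (j + v)) * ?F (j + v) = (- 1) ^ j * (?C * ((- 1) ^ v
        * (int (2 * N choose v) * int (super_catalan (j + v) l * super_catalan (2 * n - (j + v)) l))))"
      by (simp add: power_add mult_ac)
  qed
  \<comment> \<open>The quotient in the closed form need not be an integer; multiplied by
    \<open>?C\<close> it regroups into a super Catalan number and two binomials.\<close>
  also have "?C * ?H = int (super_catalan n l * super_catalan n (l + N) * (n choose j) * (2 * j choose j))"
  proof -
    have choose:
      "(of_nat (2 * n choose j) :: rat) = fact (2 * n) / (fact j * fact (j + 2 * N))"
      "(of_nat ((2 * n - j) choose j) :: rat) = fact (j + 2 * N) / (fact j * fact (2 * N))"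
      "(of_nat (n choose j) :: rat) = fact n / (fact j * fact N)"
      "(of_nat (2 * j choose j) :: rat) = fact (2 * j) / (fact j * fact j)"
      using assms by (simp_all add: binomial_fact)
    have sc: "of_nat (super_catalan n (l + N))
        = (fact (2 * n) * fact (2 * (l + N)) / (fact n * fact (l + N) * fact (l + j + 2 * N)) :: rat)"
      using super_catalan_fact[of n "l + N"] assms by (simp add: add_ac mult_2)
    have "(of_int (?C * ?H) :: rat) = of_nat (2 * n choose j) * of_nat ((2 * n - j) choose j)
        * (of_nat (super_catalan n l) * (fact (2 * j) * fact (2 * (l + N)) * fact (2 * N)
      / (fact j * fact (l + N) * fact (l + j + 2 * N) * fact N)))"
      using alternating_sum_super_catalan[of N j l] assms by simp
    also have "\<dots> = of_nat (super_catalan n l) * of_nat (super_catalan n (l + N))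
        * of_nat (n choose j) * of_nat (2 * j choose j)"
      unfolding choose sc by (simp add: divide_simps)
    finally have "(of_int (?C * ?H) :: rat) = of_int (int (super_catalan n l * super_catalan n (l + N)
        * (n choose j) * (2 * j choose j)))" by simp
    then show ?thesis by (simp only: of_int_eq_iff)
  qed
  finally show ?thesis by (simp add: mult.assoc)
qed

section \<open>Divisibility of the sums with arbitrary positive exponent\<close>

theorem theorem3:
  fixes n l m :: nat
  assumes "m > 0"
  shows "int (super_catalan n l) dvd
    (\<Sum>k = 0..2 * n. (- 1) ^ k * int ((2 * n) choose k) ^ m *
       int (super_catalan k l) * int (super_catalan (2 * n - k) l))"
proof -
  let ?F = "\<lambda>k. (- 1) ^ k * int (super_catalan k l) * int (super_catalan (2 * n - k) l)"
  have base: "int (super_catalan n l) dvd (\<Sum>k\<le>2 * n. int (binomial_kernel (2 * n) j k) * ?F k)" for j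
  proof (cases "j \<le> n")
    case True
    then obtain N where "n = j + N" using le_Suc_ex by blast
    then show ?thesis by (simp only: sum_kernel_super_catalan) simp
  next
    case False
    \<comment> \<open>For \<open>j > n\<close> the support \<open>j \<le> k \<le> 2 * n - j\<close>
      is empty.\<close>
    then have "binomial_kernel (2 * n) j k = 0" for k by (cases "k < j") (auto simp: binomial_kernel_def)
    then show ?thesis by simp
  qed
  \<comment> \<open>The kernel of index 0 supplies one of the \<open>m\<close> factors
    \<open>2 * n choose k\<close>; this uses \<open>m > 0\<close>.\<close>
  have "int (super_catalan n l) dvd
      (\<Sum>k\<le>2 * n. int (binomial_kernel (2 * n) 0 k) * int (2 * n choose k) ^ (m - 1) * ?F k)"
    by (rule dvd_sum_kernel_power[OF base]) simp
  also have "\<dots> = (\<Sum>k = 0..2 * n. (- 1) ^ k * int ((2 * n) choose k) ^ m *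
       int (super_catalan k l) * int (super_catalan (2 * n - k) l))"
    using assms
    by (intro sum.cong) (auto simp: binomial_kernel_def power_eq_if mult_ac)
  finally show ?thesis .
qed

end
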